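(* Let $f$ be a nonnegative real-valued multiplicative arithmetical function. For each prime $p$ put $\rho(p)=\sup_{\nu\ge 0} f(p^\nu)$, and suppose $\rho(p)<\infty$ for every prime $p$. Suppose that the product $$R=\prod_p\Big(1-\frac1p\Big)\rho(p)$$ (over primes in increasing order) converges, improper limits being allowed, and that $$\rho(p)\le 1+o\Big(\frac{\log p}{p}\Big)\quad (p\to\infty).$$ Then $$\limsup_{n\to\infty}\frac{f(n)}{\log\log n}\;\le\; e^{\gamma}R,$$ where $\gamma$ is Euler's constant.
   Context: A multiplicative function satisfies $f(1)=1$ and $f(mn)=f(m)f(n)$ for coprime $m,n$; in particular $\rho(p)\ge 1$. "Improper limits allowed" means the product may converge to $+\infty$ (or $0$), in which case $R$ denotes that value and the inequality is read in $[0,\infty]$. *)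

theory Defs
  imports
    "HOL-Analysis.Analysis"
    "HOL-Computational_Algebra.Primes"
    "HOL-Library.Landau_Symbols"
begin

(* Arithmetical functions are functions on the positive integers; f 0 is irrelevant throughout. *)
definition multiplicative_arith :: "(nat \<Rightarrow> real) \<Rightarrow> bool" where
  "multiplicative_arith f \<longleftrightarrow>
     f 1 = 1 \<and> (\<forall>m n. m > 0 \<longrightarrow> n > 0 \<longrightarrow> coprime m n \<longrightarrow> f (m * n) = f m * f n)"

(* Supremum in the reals: meaningful only if the set of values is bounded above. *)
definition prime_power_sup :: "(nat \<Rightarrow> real) \<Rightarrow> nat \<Rightarrow> real" where
  "prime_power_sup f p = (SUP \<nu>. f (p ^ \<nu>))"

(* Taking limits in the extended reals admits the improper values 0 and \<infinity>;
   letting x tend to infinity takes the primes in increasing order. *)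
definition has_prime_product :: "(nat \<Rightarrow> real) \<Rightarrow> ereal \<Rightarrow> bool" where
  "has_prime_product a R \<longleftrightarrow>
     (\<lambda>x::nat. ereal (\<Prod>p | prime p \<and> p \<le> x. a p)) \<longlonglongrightarrow> R"

end

theory Submission
  imports Defs
begin

text \<open>
  Since \<open>\<rho>(p) \<ge> 1\<close>, \<open>f(n)\<close> is at most the product of \<open>\<rho>(p)\<close> over the primes \<open>p \<le> log n\<close> times the
  product over the prime factors \<open>p > log n\<close>. There are at most \<open>log n / log log n\<close> of the latter,
  each with \<open>\<rho>(p) \<le> 1 + o(log log n / log n)\<close>, so they contribute a factor \<open>exp (o(1))\<close>. The theorem
  then follows from the upper half of Mertens' third theorem, that is
  \<open>\<Sum>\<^bsub>p \<le> exp N\<^esub> - log (1 - 1/p) \<le> harm N + o(1)\<close>.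

  The latter is proved by a one-sided version of Karamata's Tauberian argument. As \<open>d \<rightarrow> 0+\<close>, the
  Laplace transforms \<open>\<Sum>\<^bsub>p\<^esub> - log (1 - 1/p) p\<^sup>-\<^sup>d\<close> and \<open>\<Sum>\<^bsub>n\<^esub> exp (- d n) / n\<close> agree up to \<open>o(1)\<close>, since both
  are \<open>log (1/d) + o(1)\<close>. Hence with \<open>d = 1/N\<close> so do the sums with a polynomial \<open>g\<close>, \<open>g 0 = 0\<close>,
  applied to \<open>p\<^sup>-\<^sup>d\<close> and \<open>exp (- d n)\<close>. Taking for \<open>g\<close> a good upper approximation of the indicator of
  \<open>[1/e, 1]\<close> turns the two sums into the sum over the primes up to \<open>exp N\<close> and into \<open>harm N\<close>; so Euler's
  constant enters only through the harmonic numbers.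
\<close>

subsection \<open>Euler product and asymptotics of zeta near 1\<close>

text \<open>Sieving by one prime \<open>p\<close> at a time multiplies the sum of \<open>n\<^sup>-\<^sup>s\<close> over the surviving \<open>n\<close> by \<open>1 - p\<^sup>-\<^sup>s\<close>, and
  in the limit only \<open>n = 1\<close> survives; this gives the Euler product.\<close>
definition rough :: "nat \<Rightarrow> nat set" where
  "rough N = {n. n > 0 \<and> (\<forall>p. prime p \<longrightarrow> p dvd n \<longrightarrow> p > N)}"

lemma rough_0: "rough 0 = {0<..}"
  by (auto simp: rough_def prime_gt_0_nat)

lemma one_in_rough: "1 \<in> rough N"
  by (auto simp: rough_def)

lemma rough_subset: "rough N \<subseteq> insert 1 {N<..}"
proof
  fix n assume n: "n \<in> rough N"
  show "n \<in> insert 1 {N<..}"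
  proof (cases "n = 1")
    case False
    then obtain p where p: "prime p" "p dvd n"
      using prime_factor_nat by blast
    with n have "N < p" "p \<le> n"
      by (auto simp: rough_def intro: dvd_imp_le)
    then show ?thesis by simp
  qed simp
qed

lemma rough_Suc_not_prime: "\<not> prime (Suc N) \<Longrightarrow> rough (Suc N) = rough N"
  unfolding rough_def by (metis Suc_lessI Suc_lessD)

text \<open>Multiplying or dividing by the prime \<open>Suc N\<close> creates no prime factor up to
  \<open>N\<close>, so the multiples of \<open>Suc N\<close> inside \<open>rough N\<close> form a
  scaled copy of \<open>rough N\<close> itself.\<close>

lemma rough_Suc_prime:
  assumes "prime (Suc N)"
  shows "rough N = rough (Suc N) \<union> (\<lambda>n. Suc N * n) ` rough N"
    and "rough (Suc N) \<inter> (\<lambda>n. Suc N * n) ` rough N = {}"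
proof -
  show "rough (Suc N) \<inter> (\<lambda>n. Suc N * n) ` rough N = {}"
  proof -
    have False if "Suc N * n \<in> rough (Suc N)" for n
      using that assms unfolding rough_def by (metis (lifting) dvd_triv_left mem_Collect_eq order_less_irrefl)
    then show ?thesis by blast
  qed
  have "n \<in> (\<lambda>n. Suc N * n) ` rough N" if n: "n \<in> rough N" "n \<notin> rough (Suc N)" for n
  proof -
    from n obtain p where p: "prime p" "p dvd n" "p > N" "\<not> p > Suc N"
      by (auto simp: rough_def)
    then have "p = Suc N" by simp
    with p obtain k where k: "n = Suc N * k" by (auto elim: dvdE)
    with n have "k \<in> rough N" by (auto simp: rough_def)
    with k show ?thesis by blast
  qed
  moreover have "rough (Suc N) \<subseteq> rough N"
    by (auto simp: rough_def)
  moreover have "Suc N * n \<in> rough N" if "n \<in> rough N" for n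
    unfolding rough_def
  proof (safe)
    fix p assume p: "prime p" "p dvd Suc N * n"
    then consider "p dvd Suc N" | "p dvd n" using prime_dvd_mult_iff by blast
    then show "N < p"
    proof cases
      case 1
      with p assms have "p = Suc N" using primes_dvd_imp_eq by blast
      then show ?thesis by simp
    next
      case 2
      with p that show ?thesis by (simp add: rough_def)
    qed
  qed (use that in \<open>auto simp: rough_def\<close>)
  ultimately show "rough N = rough (Suc N) \<union> (\<lambda>n. Suc N * n) ` rough N"
    by blast
qed

lemma zeta_summable_on:
  assumes "s > 1"
  shows "(\<lambda>n. real n powr - s) summable_on A"
proof -
  have "summable (\<lambda>n. real n powr - s)"
    using assms by (simp add: summable_real_powr_iff)
  then have "(\<lambda>n. real n powr - s) summable_on UNIV"
    by (intro norm_summable_imp_summable_on) simp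
  then show ?thesis by (rule summable_on_subset_banach) simp
qed

lemma infsum_rough:
  assumes "s > 1"
  shows "infsum (\<lambda>n. real n powr - s) (rough N) =
    (\<Sum>n. real n powr - s) * (\<Prod>p | prime p \<and> p \<le> N. 1 - real p powr - s)"
proof (induction N)
  case 0
  \<comment> \<open>Adding the index 0 is harmless because \<open>0 powr - s\<close> is 0.\<close>
  have "infsum (\<lambda>n. real n powr - s) (rough 0) = infsum (\<lambda>n. real n powr - s) UNIV"
    by (rule infsum_cong_neutral) (auto simp: rough_0)
  also have "\<dots> = (\<Sum>n. real n powr - s)"
    using assms has_sum_imp_sums[OF has_sum_infsum[OF zeta_summable_on[OF assms]]]
    by (simp add: sums_iff)
  moreover have "{p::nat. prime p \<and> p \<le> 0} = {}" by auto
  ultimately show ?case by simp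
next
  case (Suc N)
  let ?F = "\<lambda>n. real n powr - s"
  show ?case
  proof (cases "prime (Suc N)")
    case True
    have "infsum ?F (rough N) = infsum ?F (rough (Suc N)) + infsum ?F ((\<lambda>n. Suc N * n) ` rough N)"
      by (subst rough_Suc_prime(1)[OF True])
        (intro infsum_Un_disjoint zeta_summable_on assms rough_Suc_prime(2) True)
    also have "infsum ?F ((\<lambda>n. Suc N * n) ` rough N) = infsum (?F \<circ> (\<lambda>n. Suc N * n)) (rough N)"
      by (rule infsum_reindex) (simp add: inj_on_def del: mult_Suc)
    also have "?F \<circ> (\<lambda>n. Suc N * n) = (\<lambda>n. ?F (Suc N) * ?F n)"
      by (simp add: o_def powr_mult del: mult_Suc of_nat_Suc)
    also have "infsum \<dots> (rough N) = ?F (Suc N) * infsum ?F (rough N)"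
      by (simp add: infsum_cmult_right' del: of_nat_Suc)
    finally have "infsum ?F (rough (Suc N)) = infsum ?F (rough N) * (1 - ?F (Suc N))"
      by (simp add: algebra_simps)
    moreover have "{p. prime p \<and> p \<le> Suc N} = insert (Suc N) {p. prime p \<and> p \<le> N}"
      using True by (auto simp: le_Suc_eq)
    ultimately show ?thesis
      using Suc.IH by (simp del: of_nat_Suc)
  next
    case False
    then have "{p. prime p \<and> p \<le> Suc N} = {p. prime p \<and> p \<le> N}"
      by (auto simp: le_Suc_eq)
    with False Suc.IH show ?thesis by (simp add: rough_Suc_not_prime)
  qed
qed

text \<open>The number 1 survives every sieve, which gives the lower bound 1. All other survivors
  exceed \<open>N\<close>, so they contribute at most a tail of a convergent series.\<close>

lemma infsum_rough_tendsto:
  assumes "s > 1"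
  shows "(\<lambda>N. infsum (\<lambda>n. real n powr - s) (rough N)) \<longlonglongrightarrow> 1"
proof (rule real_tendsto_sandwich)
  let ?F = "\<lambda>n. real n powr - s"
  have summ: "summable ?F"
    using assms by (simp add: summable_real_powr_iff)
  have "(\<lambda>N. 1 + (suminf ?F - sum ?F {..N})) \<longlonglongrightarrow> 1 + (suminf ?F - suminf ?F)"
    by (intro tendsto_intros summable_LIMSEQ' summ)
  then have lim: "(\<lambda>N. 1 + (suminf ?F - sum ?F {..N})) \<longlonglongrightarrow> 1" by simp
  have upper: "infsum ?F (rough N) \<le> 1 + (suminf ?F - sum ?F {..N})" for N
  proof -
    have "infsum ?F (rough N) \<le> infsum ?F (insert 1 {N<..})"
      by (intro infsum_mono2 zeta_summable_on assms rough_subset) auto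
    \<comment> \<open>For \<open>N = 0\<close> the number 1 already lies in the tail, which is why
      only an inequality holds.\<close>
    also have "\<dots> \<le> 1 + infsum ?F {N<..}"
      using zeta_summable_on[OF assms, of "{N<..}"]
      by (cases "1 \<in> {N<..}") (simp_all add: insert_absorb infsum_insert)
    also have "infsum ?F UNIV = infsum ?F {..N} + infsum ?F {N<..}"
      by (subst infsum_Un_disjoint[symmetric])
        (auto intro!: zeta_summable_on assms arg_cong[where f = "infsum ?F"])
    then have "infsum ?F {N<..} = suminf ?F - sum ?F {..N}"
      using has_sum_imp_sums[OF has_sum_infsum[OF zeta_summable_on[OF assms]]]
      by (simp add: sums_iff)
    finally show ?thesis .
  qed
  have "1 \<le> infsum ?F (rough N)" for N
  proof -
    have "infsum ?F {1} \<le> infsum ?F (rough N)"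
      using one_in_rough by (intro infsum_mono2 zeta_summable_on assms) auto
    then show ?thesis by simp
  qed
  then show "\<forall>\<^sub>F N in sequentially. 1 \<le> infsum ?F (rough N)" by simp
  show "\<forall>\<^sub>F N in sequentially. infsum ?F (rough N) \<le> 1 + (suminf ?F - sum ?F {..N})"
    using upper by simp
  show "(\<lambda>N. 1 + (suminf ?F - sum ?F {..N})) \<longlonglongrightarrow> 1" by (rule lim)
qed simp

text \<open>Integral test: \<open>?T n\<close> is the integral of \<open>x powr - (1 + d)\<close>
  over \<open>[n + 1, n + 2]\<close>. The integrand decreases, so this lies between its values at
  the endpoints, and the integrals telescope to \<open>1 / d\<close>.\<close>

lemma zeta_bounds:
  assumes "d > 0"
  shows "1 / d \<le> (\<Sum>n. real n powr - (1 + d))" "(\<Sum>n. real n powr - (1 + d)) \<le> 1 + 1 / d"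
proof -
  let ?F = "\<lambda>n. real n powr - (1 + d)"
  let ?T = "\<lambda>n. real (Suc n) powr - d / d - real (Suc (Suc n)) powr - d / d"
  have summ: "summable ?F"
    using assms by (subst summable_real_powr_iff) simp
  then have summ1: "summable (\<lambda>n. ?F (Suc n))" by (subst summable_Suc_iff)
  then have summ2: "summable (\<lambda>n. ?F (Suc (Suc n)))" by (subst summable_Suc_iff)
  have mvt: "?F (Suc (Suc n)) \<le> ?T n \<and> ?T n \<le> ?F (Suc n)" for n
  proof -
    have "\<exists>z. real (Suc n) < z \<and> z < real (Suc (Suc n)) \<and>
      - (real (Suc (Suc n)) powr - d / d) - - (real (Suc n) powr - d / d) = 
      (real (Suc (Suc n)) - real (Suc n)) * (z powr - (1 + d))"
    proof (rule MVT2)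
      fix x assume "real (Suc n) \<le> x"
      then have "x > 0" by simp
      then show "((\<lambda>x. - (x powr - d / d)) has_real_derivative x powr - (1 + d)) (at x)"
        using assms by (auto intro!: derivative_eq_intros simp: minus_diff_commute)
    qed simp
    then obtain z where z: "real (Suc n) < z" "z < real (Suc (Suc n))" "?T n = z powr - (1 + d)"
      by auto
    have "?F (Suc (Suc n)) \<le> z powr - (1 + d)" "z powr - (1 + d) \<le> ?F (Suc n)"
      using z assms by (auto intro!: powr_mono2')
    with z show ?thesis by simp
  qed
  have "filterlim (\<lambda>n. real (Suc n)) at_top sequentially"
    by (rule filterlim_compose[OF filterlim_real_sequentially filterlim_Suc])
  then have "(\<lambda>n. real (Suc n) powr - d / d) \<longlonglongrightarrow> 0 / d"
    using assms by (intro tendsto_divide tendsto_const tendsto_neg_powr) auto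
  then have T: "?T sums (1 / d)"
    using telescope_sums'[of "\<lambda>n. real (Suc n) powr - d / d" 0] by simp
  have "1 / d \<le> (\<Sum>n. ?F (Suc n))"
    using suminf_le[OF _ sums_summable[OF T] summ1] mvt T by (simp add: sums_iff)
  then show "1 / d \<le> suminf ?F"
    using suminf_split_head[OF summ] by simp
  have "(\<Sum>n. ?F (Suc (Suc n))) \<le> 1 / d"
    using suminf_le[OF _ summ2 sums_summable[OF T]] mvt T by (simp add: sums_iff)
  \<comment> \<open>Of the two split-off terms, the one at 0 vanishes and the one at 1 is 1.\<close>
  then show "suminf ?F \<le> 1 + 1 / d"
    using suminf_split_head[OF summ] suminf_split_head[OF summ1] by simp
qed

text \<open>By the preceding bounds \<open>d\<close> times the zeta value lies between 1 and
  \<open>1 + d\<close>.\<close>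

lemma ln_zeta_asymp: "((\<lambda>d. ln (\<Sum>n. real n powr - (1 + d)) - ln (1 / d)) \<longlongrightarrow> 0) (at_right 0)"
proof (rule real_tendsto_sandwich)
  have "((\<lambda>d::real. ln (1 + d)) \<longlongrightarrow> ln (1 + 0)) (at_right 0)"
    by (intro tendsto_intros) auto
  then have lim: "((\<lambda>d::real. ln (1 + d)) \<longlongrightarrow> 0) (at_right 0)" by simp
  have pos: "\<forall>\<^sub>F d::real in at_right 0. d > 0"
    by (simp add: eventually_at_right_less)
  show "\<forall>\<^sub>F d in at_right 0. 0 \<le> ln (\<Sum>n. real n powr - (1 + d)) - ln (1 / d)"
    using pos
  proof eventually_elim
    case (elim d)
    then show ?case using zeta_bounds(1)[of d] by (simp add: order.strict_trans2[of 0 "1/d"])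
  qed
  show "\<forall>\<^sub>F d in at_right 0. ln (\<Sum>n. real n powr - (1 + d)) - ln (1 / d) \<le> ln (1 + d)"
    using pos
  proof eventually_elim
    case (elim d)
    then have "0 < 1 / d" by simp
    have "ln (\<Sum>n. real n powr - (1 + d)) \<le> ln (1 + 1 / d)"
      using zeta_bounds[OF elim] \<open>0 < 1 / d\<close> by (subst ln_le_cancel_iff) linarith+
    also have "1 + 1 / d = (1 + d) * (1 / d)" using elim by (simp add: field_simps)
    also have "ln \<dots> = ln (1 + d) + ln (1 / d)" using elim by (subst ln_mult) auto
    finally show ?case by simp
  qed
  show "((\<lambda>d::real. ln (1 + d)) \<longlongrightarrow> 0) (at_right 0)" by (rule lim)
qed simp

subsection \<open>Laplace transforms of the prime and the harmonic weights\<close>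

text \<open>Weighting by the logarithm of the Euler factor rather than by \<open>1 / p\<close> makes
  the exponential of a partial sum exactly the reciprocal of Mertens' product.\<close>

definition prime_weight :: "nat \<Rightarrow> real" where
  "prime_weight p = (if prime p then - ln (1 - 1 / real p) else 0)"

lemma neg_ln_one_minus_bounds:
  fixes x :: real
  assumes "0 \<le> x" "x \<le> 1/2"
  shows "x \<le> - ln (1 - x)" "- ln (1 - x) \<le> x + 2 * x\<^sup>2"
  using ln_one_minus_pos_upper_bound[of x] ln_one_minus_pos_lower_bound[of x] assms by auto

lemma prime_inverse_le_half: "prime p \<Longrightarrow> 1 / real p \<le> 1 / 2"
  using prime_ge_2_nat[of p] by (simp add: field_simps)

lemma prime_weight_nonneg: "0 \<le> prime_weight p"
proof (cases "prime p")
  case True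
  have "0 \<le> 1 / real p" by simp
  also have "1 / real p \<le> - ln (1 - 1 / real p)"
    by (intro neg_ln_one_minus_bounds(1) prime_inverse_le_half True) simp
  finally show ?thesis by (simp add: prime_weight_def)
qed (simp add: prime_weight_def)

text \<open>The sieved sums are zeta times the finite products and tend to 1, so these products tend
  to the reciprocal of zeta; it remains to take logarithms.\<close>

lemma ln_zeta_sums:
  assumes "s > 1"
  shows "(\<lambda>p. if prime p then - ln (1 - real p powr - s) else 0) sums ln (\<Sum>n. real n powr - s)"
proof -
  let ?Z = "\<Sum>n. real n powr - s"
  let ?P = "\<lambda>N. \<Prod>p | prime p \<and> p \<le> N. 1 - real p powr - s"
  have "0 < 1 / (s - 1)" using assms by simp
  also have "1 / (s - 1) \<le> ?Z"
    using zeta_bounds(1)[of "s - 1"] assms by simp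
  finally have Z: "?Z > 0" .
  have "(\<lambda>N. ?Z * ?P N) \<longlonglongrightarrow> 1"
    using infsum_rough_tendsto[OF assms] by (simp add: infsum_rough[OF assms])
  from tendsto_divide[OF this tendsto_const[of ?Z]] have "?P \<longlonglongrightarrow> 1 / ?Z"
    using Z by simp
  then have "(\<lambda>N. - ln (?P N)) \<longlonglongrightarrow> - ln (1 / ?Z)"
    using Z by (intro tendsto_intros) auto
  also have "- ln (1 / ?Z) = ln ?Z"
    using Z by (simp add: ln_div)
  also have "(\<lambda>N. - ln (?P N)) = (\<lambda>N. \<Sum>p\<le>N. if prime p then - ln (1 - real p powr - s) else 0)"
  proof
    fix N
    have "ln (?P N) = (\<Sum>p | prime p \<and> p \<le> N. ln (1 - real p powr - s))"
    proof (rule ln_prod)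
      fix p assume "p \<in> {p. prime p \<and> p \<le> N}"
      then have "real p > 1" using prime_gt_1_nat by auto
      then show "1 - real p powr - s \<noteq> 0"
        using assms powr_less_one[of "real p" "- s"] by simp
    qed simp
    also have "\<dots> = (\<Sum>p\<le>N. if prime p then ln (1 - real p powr - s) else 0)"
      by (subst sum.inter_filter[symmetric]) (auto intro: sum.cong)
    finally show "- ln (?P N) = (\<Sum>p\<le>N. if prime p then - ln (1 - real p powr - s) else 0)"
      by (auto simp flip: sum_negf intro: sum.cong)
  qed
  finally show ?thesis by (simp add: sums_def_le)
qed

text \<open>With \<open>x = 1 / p\<close> and \<open>y = p powr - d\<close>, both terms equal
  \<open>x * y\<close> up to an error between 0 and \<open>2 * x^2\<close>. The bound is uniform in
  \<open>d\<close>, as dominated convergence requires.\<close>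

lemma prime_weight_twist:
  assumes "d > 0"
  shows "\<bar>prime_weight p * real p powr - d - (if prime p then - ln (1 - real p powr - (1 + d)) else 0)\<bar>
    \<le> 2 / real p ^ 2"
proof (cases "prime p")
  case True
  define x y where "x = 1 / real p" and "y = real p powr - d"
  have p: "real p > 1" using True prime_gt_1_nat by auto
  have x: "0 < x" "x \<le> 1/2" using p prime_inverse_le_half[OF True] by (auto simp: x_def)
  have y: "0 < y" "y \<le> 1" using p assms powr_mono[of "- d" 0 "real p"] by (auto simp: y_def)
  have xy: "real p powr - (1 + d) = x * y"
    using p by (simp add: x_def y_def powr_diff powr_minus divide_simps powr_add)
  have "0 \<le> x * y" "x * y \<le> x" using x y mult_left_le[of y x] by simp_all
  with x y have bounds: "0 \<le> x * y" "x * y \<le> 1/2" by linarith+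
  note b1 = neg_ln_one_minus_bounds[OF less_imp_le[OF x(1)] x(2)] and b2 = neg_ln_one_minus_bounds[OF bounds]
  have "- ln (1 - x) * y \<le> (x + 2 * x\<^sup>2) * y" "x * y \<le> - ln (1 - x) * y"
    using mult_right_mono[OF b1(2), of y] mult_right_mono[OF b1(1), of y] y by simp_all
  moreover have "x\<^sup>2 * y \<le> x\<^sup>2" "(x * y)\<^sup>2 \<le> x\<^sup>2"
    using x y \<open>x * y \<le> x\<close> by (auto simp: mult_left_le intro: power_mono)
  ultimately have "\<bar>- ln (1 - x) * y - - ln (1 - x * y)\<bar> \<le> 2 * x\<^sup>2"
    using b2 by (simp add: algebra_simps abs_le_iff)
  then show ?thesis
    using True unfolding xy by (simp add: prime_weight_def x_def y_def power_divide)
qed (simp add: prime_weight_def)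

lemma summable_2_over_square: "summable (\<lambda>p. 2 / real p ^ 2)"
proof -
  have "summable (\<lambda>p. 2 * inverse (real p ^ 2))"
    by (intro summable_mult inverse_power_summable) simp
  then show ?thesis by (simp add: field_simps)
qed

lemma prime_weight_summable:
  assumes "d > 0"
  shows "summable (\<lambda>p. prime_weight p * real p powr - d)"
proof -
  let ?b = "\<lambda>p. if prime p then - ln (1 - real p powr - (1 + d)) else 0"
  have "summable (\<lambda>p. prime_weight p * real p powr - d - ?b p)"
    by (rule summable_comparison_test'[OF summable_2_over_square]) 
      (use prime_weight_twist[OF assms] in simp)
  moreover have "summable ?b"
    using ln_zeta_sums[of "1 + d"] assms by (simp add: sums_iff)
  ultimately have "summable (\<lambda>p. prime_weight p * real p powr - d - ?b p + ?b p)"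
    by (rule summable_add)
  then show ?thesis by simp
qed

text \<open>For each fixed prime both terms tend to \<open>- ln (1 - 1 / p)\<close>, and the
  majorant \<open>2 / p^2\<close>, independent of \<open>d\<close>, allows the limit to be taken
  inside the series by Tannery's theorem.\<close>

lemma prime_weight_suminf_minus_ln_zeta:
  "((\<lambda>d. (\<Sum>p. prime_weight p * real p powr - d) - ln (\<Sum>n. real n powr - (1 + d))) \<longlongrightarrow> 0) (at_right 0)"
proof -
  let ?b = "\<lambda>d p. if prime p then - ln (1 - real p powr - (1 + d)) else 0"
  let ?c = "\<lambda>p d. prime_weight p * real p powr - d - ?b d p"
  have pos: "\<forall>\<^sub>F d::real in at_right 0. d > 0"
    by (simp add: eventually_at_right_less)
  have lim: "((\<lambda>d. ?c p d) \<longlongrightarrow> 0) (at_right 0)" for p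
  proof (cases "prime p")
    case True
    then have p: "real p > 1" using prime_gt_1_nat by auto
    have "((\<lambda>d. prime_weight p * real p powr - d - - ln (1 - real p powr - (1 + d))) 
      \<longlongrightarrow> prime_weight p * real p powr - 0 - - ln (1 - real p powr - (1 + 0))) (at_right 0)"
      using p by (intro tendsto_intros) (auto simp: powr_minus field_simps)
    with True p show ?thesis by (simp add: prime_weight_def powr_minus field_simps)
  qed (simp add: prime_weight_def)
  have "((\<lambda>d. \<Sum>p. ?c p d) \<longlongrightarrow> (\<Sum>p. 0)) (at_right 0)"
  proof (rule tannerys_theorem[THEN conjunct2, THEN conjunct2])
    show "\<forall>\<^sub>F (p, d) in at_top \<times>\<^sub>F at_right 0. norm (?c p d) \<le> 2 / real p ^ 2"
      unfolding case_prod_beta real_norm_def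
      by (rule eventually_mono[OF eventually_prodI[OF always_eventually[of "\<lambda>_. True"] pos]])
        (use prime_weight_twist in auto)
  qed (use lim summable_2_over_square in auto)
  moreover have "\<forall>\<^sub>F d in at_right 0. (\<Sum>p. ?c p d) =
    (\<Sum>p. prime_weight p * real p powr - d) - ln (\<Sum>n. real n powr - (1 + d))"
    using pos
  proof eventually_elim
    case (elim d)
    then have "?b d sums ln (\<Sum>n. real n powr - (1 + d))"
      using ln_zeta_sums[of "1 + d"] by simp
    then show ?case
      using suminf_diff[OF prime_weight_summable[OF elim] sums_summable[of "?b d"]] 
      by (simp add: sums_iff)
  qed
  ultimately show ?thesis by (simp add: tendsto_cong)
qed

section \<open>The harmonic side and its comparison with the primes\<close>

lemma exp_over_sums:
  assumes "d > 0"
  shows "(\<lambda>n. exp (- d * real n) / real n) sums - ln (1 - exp (- d))"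
proof -
  \<comment> \<open>Mercator's series at \<open>- exp (- d)\<close>; its term at 0 is 0, by division
    by zero.\<close>
  have "(\<lambda>n. - ((- (- exp (- d))) ^ n) / of_nat n) sums ln (1 + - exp (- d))"
    using assms by (intro ln_series') simp
  from sums_minus[OF this] show ?thesis
    by (simp flip: exp_of_nat2_mult)
qed

text \<open>The quotient \<open>(1 - exp (- d)) / d\<close> is a difference quotient of the
  exponential function at 0 and tends to 1.\<close>

lemma ln_one_minus_exp_asymp:
  "((\<lambda>d::real. ln (1 / d) + ln (1 - exp (- d))) \<longlongrightarrow> 0) (at_right 0)"
proof -
  have "filterlim (\<lambda>d::real. - d) (at 0) (at_right 0)"
    by (auto simp: filterlim_at eventually_at_filter intro!: tendsto_eq_intros)
  then have "((\<lambda>d::real. (exp (- d) - 1) / - d) \<longlongrightarrow> 1) (at_right 0)"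
    by (rule filterlim_compose[OF lim_exp_minus_1])
  then have "((\<lambda>d::real. ln ((exp (- d) - 1) / - d)) \<longlongrightarrow> ln 1) (at_right 0)"
    by (intro tendsto_intros) auto
  moreover have "\<forall>\<^sub>F d::real in at_right 0. ln ((exp (- d) - 1) / - d) = ln (1 / d) + ln (1 - exp (- d))"
    using eventually_at_right_less
  proof eventually_elim
    case (elim d)
    have "(exp (- d) - 1) / - d = (1 / d) * (1 - exp (- d))"
      using elim by (simp add: field_simps)
    also have "ln \<dots> = ln (1 / d) + ln (1 - exp (- d))"
      using elim by (intro ln_mult_pos) auto
    finally show ?case .
  qed
  ultimately show ?thesis by (simp add: tendsto_cong)
qed

definition laplace_diff :: "real \<Rightarrow> real" where
  "laplace_diff d = (\<Sum>p. prime_weight p * real p powr - d) - (\<Sum>n. exp (- d * real n) / real n)"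

text \<open>Both transforms are compared with \<open>ln (1 / d)\<close>, the prime one through the
  logarithm of zeta; the three differences telescope.\<close>

lemma laplace_diff_tendsto: "(laplace_diff \<longlongrightarrow> 0) (at_right 0)"
proof -
  have "\<forall>\<^sub>F d in at_right 0. 
    ((\<Sum>p. prime_weight p * real p powr - d) - ln (\<Sum>n. real n powr - (1 + d)))
      + (ln (\<Sum>n. real n powr - (1 + d)) - ln (1 / d)) + (ln (1 / d) + ln (1 - exp (- d))) = laplace_diff d"
    using eventually_at_right_less
  proof eventually_elim
    case (elim d)
    with exp_over_sums[OF elim] show ?case
      by (simp add: laplace_diff_def sums_iff)
  qed
  moreover have "((\<lambda>d. ((\<Sum>p. prime_weight p * real p powr - d) - ln (\<Sum>n. real n powr - (1 + d)))
      + (ln (\<Sum>n. real n powr - (1 + d)) - ln (1 / d)) + (ln (1 / d) + ln (1 - exp (- d)))) \<longlongrightarrow> 0 + 0 + 0)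
      (at_right 0)"
    by (intro tendsto_add prime_weight_suminf_minus_ln_zeta ln_zeta_asymp ln_one_minus_exp_asymp)
  ultimately show ?thesis by (simp add: tendsto_cong)
qed

subsection \<open>A one-sided Mertens estimate\<close>

text \<open>These are exactly the polynomials with value 0 at 0 and 1 at 1. The zero at 0 makes the
  weighted series converge; fixing both end values lets the approximation error carry the factor
  \<open>t * (1 - t)\<close>.\<close>

definition poly_weight :: "(nat \<Rightarrow> real) \<Rightarrow> nat \<Rightarrow> real \<Rightarrow> real" where
  "poly_weight c m t = t + t * (1 - t) * (\<Sum>i\<le>m. c i * t ^ i)"

text \<open>A continuous ramp \<open>r\<close> from \<open>a\<close> to \<open>b\<close> lies
  between the two indicators. Writing it as \<open>t + t * (1 - t) * w t\<close> with continuous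
  \<open>w\<close> reduces the claim to approximating \<open>w\<close> from above.\<close>

lemma poly_weight_exists:
  assumes ab: "0 < a" "a < b" "b < 1" and "e > 0"
  shows "\<exists>c m. \<forall>t\<in>{0..1}. of_bool (b \<le> t) \<le> poly_weight c m t \<and>
    poly_weight c m t \<le> of_bool (a \<le> t) + e * (t * (1 - t))"
proof -
  define r where "r t = max 0 (min 1 ((t - a) / (b - a)))" for t
  \<comment> \<open>This is \<open>(r t - t) / (t * (1 - t))\<close> in partial fractions. Where
    \<open>min\<close> or \<open>max\<close> alters a denominator, the corresponding numerator is 0,
    so they only remove the singularities.\<close>
  define w where "w t = (1 - r t) * (- 1 / (1 - min t b)) + r t / max t a" for t
  have r: "0 \<le> r t" "r t \<le> 1" "t \<le> a \<Longrightarrow> r t = 0" "b \<le> t \<Longrightarrow> r t = 1" for t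
    using ab by (auto simp: r_def divide_simps)
  have w: "t + t * (1 - t) * w t = r t" if "t \<in> {0..1}" for t
  proof -
    consider "t \<le> a" | "b \<le> t" | "a < t" "t < b" by linarith
    then show ?thesis
    proof cases
      case 3
      then have "1 - t \<noteq> 0" "t \<noteq> 0" using ab by auto
      with 3 show ?thesis by (simp add: w_def field_simps)
    qed (use ab r in \<open>auto simp: w_def divide_simps\<close>)
  qed
  have "continuous_on {0..1} w"
    unfolding w_def r_def using ab by (intro continuous_intros) auto
  \<comment> \<open>The shift by \<open>e / 2\<close> turns a two-sided approximation within
    \<open>e / 2\<close> into \<open>w \<le> q \<le> w + e\<close>.\<close>
  then have "continuous_on {0..1} (\<lambda>t. w t + e / 2)" by (intro continuous_intros)
  then obtain q where q: "real_polynomial_function q" "\<And>t. t \<in> {0..1} \<Longrightarrow> \<bar>w t + e / 2 - q t\<bar> < e / 2"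
    using Stone_Weierstrass_real_polynomial_function[of "{0..1}" "\<lambda>t. w t + e / 2" "e / 2"] \<open>e > 0\<close>
    by auto
  then obtain c m where cm: "q = (\<lambda>t. \<Sum>i\<le>m. c i * t ^ i)"
    using real_polynomial_function_iff_sum by auto
  have "r t \<le> poly_weight c m t" "poly_weight c m t \<le> r t + e * (t * (1 - t))" if t: "t \<in> {0..1}" for t
  proof -
    have "w t \<le> q t" "q t \<le> w t + e" using q(2)[OF t] by linarith+
    then have "t * (1 - t) * w t \<le> t * (1 - t) * q t" "t * (1 - t) * q t \<le> t * (1 - t) * (w t + e)"
      using t by (auto intro!: mult_left_mono)
    then show "r t \<le> poly_weight c m t" "poly_weight c m t \<le> r t + e * (t * (1 - t))"
      using w[OF t] by (auto simp: poly_weight_def cm algebra_simps)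
  qed
  moreover have "of_bool (b \<le> t) \<le> r t" "r t \<le> of_bool (a \<le> t)" for t
    using r[of t] by (auto simp: of_bool_def)
  ultimately show ?thesis by (meson add_right_mono order_trans)
qed

text \<open>By linearity. Only positive powers occur because the weight vanishes at 0; the power 0
  would give a divergent series in both applications.\<close>

lemma poly_weight_sums:
  fixes u x :: "nat \<Rightarrow> real"
  assumes "\<And>k. k > 0 \<Longrightarrow> (\<lambda>n. u n * x n ^ k) sums L k"
  shows "(\<lambda>n. u n * poly_weight c m (x n)) sums (L 1 + (\<Sum>i\<le>m. c i * (L (i + 1) - L (i + 2))))"
proof -
  have "(\<lambda>n. u n * x n ^ 1 + (\<Sum>i\<le>m. c i * (u n * x n ^ (i + 1) - u n * x n ^ (i + 2)))) sums
    (L 1 + (\<Sum>i\<le>m. c i * (L (i + 1) - L (i + 2))))"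
    by (intro sums_add sums_sum sums_mult sums_diff assms) auto
  also have "(\<lambda>n. u n * x n ^ 1 + (\<Sum>i\<le>m. c i * (u n * x n ^ (i + 1) - u n * x n ^ (i + 2)))) =
    (\<lambda>n. u n * poly_weight c m (x n))"
    by (simp add: poly_weight_def algebra_simps sum_distrib_left sum_subtractf fun_eq_iff)
  finally show ?thesis .
qed

section \<open>Transfer of polynomial weights from the primes to the harmonic series\<close>

lemma prime_weight_poly_sums:
  assumes "d > 0"
  defines "G \<equiv> \<lambda>d. \<Sum>p. prime_weight p * real p powr - d"
  shows "(\<lambda>p. prime_weight p * poly_weight c m (real p powr - d)) sums
    (G d + (\<Sum>i\<le>m. c i * (G (real (i + 1) * d) - G (real (i + 2) * d))))"
proof -
  \<comment> \<open>A power of the kernel is the kernel at \<open>k * d\<close>, so it yields the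
    transform at a rescaled argument.\<close>
  have "(\<lambda>p. prime_weight p * (real p powr - d) ^ k) sums G (real k * d)" if "k > 0" for k
  proof -
    have "(\<lambda>p. prime_weight p * real p powr - (real k * d)) sums G (real k * d)"
      unfolding G_def using assms that by (intro summable_sums prime_weight_summable) simp
    moreover have "prime_weight p * (real p powr - d) ^ k = prime_weight p * real p powr - (real k * d)" for p
    proof (cases "prime p")
      case True
      then have "real p \<noteq> 0" by auto
      then show ?thesis by (simp add: powr_power mult.commute)
    qed (simp add: prime_weight_def)
    ultimately show ?thesis by (simp only:)
  qed
  from poly_weight_sums[OF this, of c m] show ?thesis by simp
qed

lemma harmonic_poly_sums:
  assumes "d > 0"
  defines "H \<equiv> \<lambda>d. \<Sum>n. exp (- d * real n) / real n"
  shows "(\<lambda>n. poly_weight c m (exp (- d * real n)) / real n) sums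
    (H d + (\<Sum>i\<le>m. c i * (H (real (i + 1) * d) - H (real (i + 2) * d))))"
proof -
  have "(\<lambda>n. 1 / real n * exp (- d * real n) ^ k) sums H (real k * d)" if "k > 0" for k
  proof -
    have "(\<lambda>n. exp (- (real k * d) * real n) / real n) sums H (real k * d)"
      unfolding H_def using exp_over_sums[of "real k * d"] assms that by (simp add: sums_iff)
    then show ?thesis by (simp flip: exp_of_nat_mult add: mult.assoc)
  qed
  from poly_weight_sums[OF this, of c m] show ?thesis by simp
qed

text \<open>Both sums are the same finite combination of transform values at multiples of
  \<open>d\<close>. Their difference is that combination of values of \<open>laplace_diff\<close>,
  each of which tends to 0.\<close>

lemma poly_weight_comparison:
  "((\<lambda>d. (\<Sum>p. prime_weight p * poly_weight c m (real p powr - d)) -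
      (\<Sum>n. poly_weight c m (exp (- d * real n)) / real n)) \<longlongrightarrow> 0) (at_right 0)"
proof -
  have lim: "((\<lambda>d. laplace_diff (real k * d)) \<longlongrightarrow> 0) (at_right 0)" if "k > 0" for k
  proof (rule filterlim_compose[OF laplace_diff_tendsto])
    have "((\<lambda>d. real k * d) \<longlongrightarrow> real k * 0) (at_right 0)" by (intro tendsto_intros)
    moreover have "\<forall>\<^sub>F d in at_right 0. real k * d > 0"
      using eventually_at_right_less by eventually_elim (use that in simp)
    ultimately show "filterlim (\<lambda>d. real k * d) (at_right 0) (at_right 0)"
      by (intro tendsto_imp_filterlim_at_right) simp_all
  qed
  have "((\<lambda>d. laplace_diff d + (\<Sum>i\<le>m. c i * (laplace_diff (real (i + 1) * d) - laplace_diff (real (i + 2) * d))))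
    \<longlongrightarrow> 0 + (\<Sum>i\<le>m. c i * (0 - 0))) (at_right 0)"
    by (intro tendsto_add tendsto_sum tendsto_mult tendsto_const tendsto_diff lim laplace_diff_tendsto) auto
  moreover have "\<forall>\<^sub>F d in at_right 0.
    laplace_diff d + (\<Sum>i\<le>m. c i * (laplace_diff (real (i + 1) * d) - laplace_diff (real (i + 2) * d))) =
    (\<Sum>p. prime_weight p * poly_weight c m (real p powr - d)) -
      (\<Sum>n. poly_weight c m (exp (- d * real n)) / real n)"
    using eventually_at_right_less
  proof eventually_elim
    case (elim d)
    show ?case
      unfolding sums_unique[OF prime_weight_poly_sums[OF elim], symmetric]
        sums_unique[OF harmonic_poly_sums[OF elim], symmetric] laplace_diff_def
      by (simp add: algebra_simps sum.distrib sum_subtractf)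
  qed
  ultimately show ?thesis by (simp add: tendsto_cong)
qed

text \<open>With \<open>d = 1 / N\<close> the indicator selects
  \<open>n \<le> (1 + \<theta>) * N\<close>: this gives \<open>harm N\<close> and at most
  \<open>\<theta> * N\<close> further terms of size at most \<open>1 / N\<close>. In the error term
  \<open>1 - t \<le> d * n\<close> cancels the denominator, leaving a geometric series.\<close>

lemma harmonic_poly_bound:
  assumes "N > 0" "\<theta> > 0" "e > 0"
    and g: "\<And>t. t \<in> {0..1} \<Longrightarrow> 0 \<le> poly_weight c m t"
      "\<And>t. t \<in> {0..1} \<Longrightarrow> poly_weight c m t \<le> of_bool (exp (- (1 + \<theta>)) \<le> t) + e * (t * (1 - t))"
  shows "(\<Sum>n. poly_weight c m (exp (- (1 / real N) * real n)) / real n) \<le> harm N + \<theta> + 2 * e"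
proof -
  define d where "d = 1 / real N"
  have d: "0 < d" "d \<le> 1" using assms by (auto simp: d_def)
  define K where "K = nat \<lfloor>real N * (1 + \<theta>)\<rfloor>"
  have K: "n \<le> K \<longleftrightarrow> real n \<le> real N * (1 + \<theta>)" for n
    using assms unfolding K_def by (simp add: le_nat_iff le_floor_iff)
  have "N \<le> K" unfolding K using assms by simp
  let ?h = "\<lambda>n. poly_weight c m (exp (- d * real n)) / real n"
  let ?k = "\<lambda>n. (if n \<in> {1..K} then 1 / real n else 0) + e * d * exp (- d) ^ n"
  \<comment> \<open>At \<open>n = 0\<close> the left-hand side is 0, by division by zero.\<close>
  have le: "?h n \<le> ?k n" for n
  proof (cases "n = 0")
    case False
    define t where "t = exp (- d * real n)"
    have t: "t \<in> {0..1}" using d by (simp add: t_def)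
    have "exp (- (1 + \<theta>)) \<le> t \<longleftrightarrow> n \<le> K"
      unfolding K using assms by (simp add: t_def d_def field_simps)
    with g(2)[OF t] have "poly_weight c m t \<le> of_bool (n \<le> K) + e * (t * (1 - t))" by simp
    also have "1 - t \<le> d * real n" using exp_ge_add_one_self[of "- d * real n"] by (simp add: t_def)
    then have "e * (t * (1 - t)) \<le> e * (t * (d * real n))"
      using t assms by (intro mult_left_mono) auto
    finally have "poly_weight c m t / real n \<le> (of_bool (n \<le> K) + e * (t * (d * real n))) / real n"
      by (intro divide_right_mono) auto
    also have "\<dots> = of_bool (n \<le> K) / real n + e * d * t" using False by (simp add: field_simps)
    finally have "poly_weight c m t / real n \<le> of_bool (n \<le> K) / real n + e * d * t" .
    moreover have "exp (- d) ^ n = t" by (simp add: t_def flip: exp_of_nat2_mult)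
    ultimately show ?thesis using False by (cases "n \<le> K") (simp_all add: t_def)
  qed (use assms d in simp)
  have "norm (exp (- d)) < 1" using d by simp
  then have k: "?k sums ((\<Sum>n\<in>{1..K}. 1 / real n) + e * d * (1 / (1 - exp (- d))))"
    by (intro sums_add sums_If_finite_set sums_mult geometric_sums) simp
  have h_nonneg: "0 \<le> ?h n" for n using d by (intro divide_nonneg_nonneg g) auto
  have "summable ?h"
  proof (rule summable_comparison_test'[OF sums_summable[OF k]])
    show "norm (?h n) \<le> ?k n" for n
      unfolding real_norm_def abs_of_nonneg[OF h_nonneg] by (rule le)
  qed
  then have "suminf ?h \<le> (\<Sum>n\<in>{1..K}. 1 / real n) + e * (d * (1 / (1 - exp (- d))))"
    using suminf_le[OF le _ sums_summable[OF k]] sums_unique[OF k] by simp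
  also have "(\<Sum>n\<in>{1..K}. 1 / real n) = (\<Sum>n\<in>{1..N}. 1 / real n) + (\<Sum>n\<in>{N<..K}. 1 / real n)"
    using \<open>N \<le> K\<close> by (subst sum.union_disjoint[symmetric]) (auto intro: sum.cong)
  also have "(\<Sum>n\<in>{N<..K}. 1 / real n) \<le> (\<Sum>n\<in>{N<..K}. d)"
    using assms unfolding d_def by (intro sum_mono divide_left_mono) auto
  also have "\<dots> = d * (real K - real N)" using \<open>N \<le> K\<close> by (simp add: of_nat_diff)
  also have "\<dots> \<le> d * (real N * \<theta>)"
    using K[of K] d by (intro mult_left_mono) (auto simp: algebra_simps)
  also have "\<dots> = \<theta>" using assms by (simp add: d_def)
  also have "(\<Sum>n\<in>{1..N}. 1 / real n) = harm N" by (simp add: harm_def inverse_eq_divide)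
  \<comment> \<open>The geometric error sum stays bounded uniformly in \<open>N\<close>; this uses
    \<open>d \<le> 1\<close>.\<close>
  also have "d * (1 / (1 - exp (- d))) \<le> 2"
  proof -
    have "exp (- d) \<le> 1 / (1 + d)"
      using exp_ge_add_one_self[of d] d by (simp add: exp_minus field_simps)
    then have "d / (1 + d) \<le> 1 - exp (- d)" using d by (simp add: field_simps)
    moreover have "d / 2 \<le> d / (1 + d)" using d by (intro divide_left_mono) auto
    ultimately have "d / 2 \<le> 1 - exp (- d)" by (rule order_trans[rotated])
    then show ?thesis using d by (simp add: field_simps)
  qed
  finally show ?thesis using assms by (simp add: d_def mult.commute)
qed

text \<open>For \<open>d = 1 / N\<close> the condition \<open>p \<le> exp N\<close> becomes
  \<open>exp (- 1) \<le> p powr - d\<close>. A polynomial majorant of that indicator bounds the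
  prime sum, and the comparison moves it to the harmonic series.\<close>

lemma sum_prime_weight_le:
  assumes "e > 0"
  shows "\<forall>\<^sub>F N in sequentially. (\<Sum>p | prime p \<and> real p \<le> exp (real N). prime_weight p) \<le> harm N + e"
proof -
  \<comment> \<open>The error \<open>e\<close> is spent in quarters: one on the comparison of the
    two sums, one on the extra harmonic terms up to \<open>(1 + e / 4) * N\<close>, and two on the
    polynomial error.\<close>
  define a where "a = exp (- (1 + e / 4))"
  have "\<exists>c m. \<forall>t\<in>{0..1}. of_bool (exp (- 1) \<le> t) \<le> poly_weight c m t \<and>
    poly_weight c m t \<le> of_bool (a \<le> t) + (e / 4) * (t * (1 - t))"
    by (rule poly_weight_exists) (use assms in \<open>auto simp: a_def\<close>)
  then obtain c m where cm: "\<And>t. t \<in> {0..1} \<Longrightarrow> of_bool (exp (- 1) \<le> t) \<le> poly_weight c m t"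
    "\<And>t. t \<in> {0..1} \<Longrightarrow> poly_weight c m t \<le> of_bool (a \<le> t) + (e / 4) * (t * (1 - t))"
    by blast
  have nonneg: "0 \<le> poly_weight c m t" if "t \<in> {0..1}" for t
    using cm(1)[OF that] by (auto simp: of_bool_def split: if_splits)
  have "filterlim (\<lambda>N. 1 / real N) (at_right 0) sequentially"
    by (intro tendsto_imp_filterlim_at_right lim_1_over_n)
      (use eventually_gt_at_top[of 0] in eventually_elim, simp)
  from order_tendstoD(2)[OF filterlim_compose[OF poly_weight_comparison this], of "e / 4" c m]
  have "\<forall>\<^sub>F N in sequentially.
    (\<Sum>p. prime_weight p * poly_weight c m (real p powr - (1 / real N))) -
      (\<Sum>n. poly_weight c m (exp (- (1 / real N) * real n)) / real n) < e / 4"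
    using assms by simp
  then show ?thesis using eventually_gt_at_top[of 0]
  proof eventually_elim
    case (elim N)
    let ?f = "\<lambda>p. prime_weight p * poly_weight c m (real p powr - (1 / real N))"
    let ?S = "{p. prime p \<and> real p \<le> exp (real N)}"
    have d: "1 / real N > 0" using elim by simp
    have le1: "real p powr - (1 / real N) \<in> {0..1}" if "prime p" for p
      using powr_mono[of "- (1 / real N)" 0 "real p"] prime_gt_1_nat[OF that] d by auto
    have "finite ?S"
      by (rule finite_subset[of _ "{..nat \<lfloor>exp (real N)\<rfloor>}"]) (auto simp: le_nat_floor)
    have "sum prime_weight ?S \<le> sum ?f ?S"
    proof (rule sum_mono)
      fix p assume p: "p \<in> ?S"
      then have p1: "real p > 1" using prime_gt_1_nat by auto
      have "ln (real p) \<le> real N" using p p1 ln_le_cancel_iff[of "real p" "exp (real N)"] by simp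
      then have "exp (- 1) \<le> real p powr - (1 / real N)"
        using p1 elim by (simp add: powr_def field_simps)
      then have "1 \<le> poly_weight c m (real p powr - (1 / real N))"
        using cm(1)[OF le1[of p]] p \<open>exp (- 1) \<le> _\<close> by simp
      then show "prime_weight p \<le> ?f p"
        using prime_weight_nonneg mult_left_mono[of 1] by fastforce
    qed
    also have "\<dots> \<le> suminf ?f"
    proof (intro sum_le_suminf \<open>finite ?S\<close> sums_summable[OF prime_weight_poly_sums[OF d]])
      fix p show "0 \<le> ?f p"
        using mult_nonneg_nonneg[OF prime_weight_nonneg[of p] nonneg[OF le1[of p]]]
        by (cases "prime p") (auto simp: prime_weight_def)
    qed
    also have "\<dots> \<le> e / 4 + (\<Sum>n. poly_weight c m (exp (- (1 / real N) * real n)) / real n)"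
      using elim by simp
    also have "\<dots> \<le> e / 4 + (harm N + e / 4 + 2 * (e / 4))"
      using assms elim nonneg cm(2) by (intro add_left_mono harmonic_poly_bound) (auto simp: a_def)
    finally show ?case by simp
  qed
qed

subsection \<open>The largest order of a multiplicative function\<close>

lemma multiplicative_arith_prod:
  assumes "multiplicative_arith f" "finite S" "\<And>p. p \<in> S \<Longrightarrow> prime p"
  shows "f (\<Prod>p\<in>S. p ^ e p) = (\<Prod>p\<in>S. f (p ^ e p))"
  using assms(2,3)
proof (induction S)
  case empty
  then show ?case using assms(1) by (simp add: multiplicative_arith_def)
next
  case (insert q S)
  have "coprime (q ^ e q) (\<Prod>p\<in>S. p ^ e p)"
  proof (rule prod_coprime_right)
    fix p assume "p \<in> S"
    with insert have "coprime q p" by (intro primes_coprime) auto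
    then show "coprime (q ^ e q) (p ^ e p)" by simp
  qed
  moreover have "q ^ e q > 0" "(\<Prod>p\<in>S. p ^ e p) > 0"
    using insert by (auto intro!: prod_pos simp: prime_gt_0_nat)
  ultimately show ?case
    using insert assms(1) by (simp add: multiplicative_arith_def)
qed

lemma multiplicative_arith_prime_factors:
  assumes "multiplicative_arith f" "n > 0"
  shows "f n = (\<Prod>p\<in>prime_factors n. f (p ^ multiplicity p n))"
  using multiplicative_arith_prod[OF assms(1), of "prime_factors n" "\<lambda>p. multiplicity p n"]
    prime_factorization_nat[OF assms(2)] by auto

text \<open>The product of distinct prime factors divides \<open>n\<close>, and each factor counted
  here exceeds \<open>y\<close>.\<close>

lemma card_large_prime_factors:
  assumes "n > 0" "y > 1"
  shows "real (card {p \<in> prime_factors n. y < real p}) * ln y \<le> ln (real n)"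
proof -
  let ?S = "{p \<in> prime_factors n. y < real p}"
  have "y ^ card ?S = (\<Prod>p\<in>?S. y)" by simp
  also have "\<dots> \<le> (\<Prod>p\<in>?S. real p)" using assms by (intro prod_mono) auto
  also have "\<dots> = real (\<Prod>?S)" by simp
  also have "\<Prod>?S dvd n"
  proof -
    have "\<Prod>?S dvd (\<Prod>p\<in>prime_factors n. p)" by (rule prod_dvd_prod_subset) auto
    also have "\<dots> dvd (\<Prod>p\<in>prime_factors n. p ^ multiplicity p n)"
      by (intro prod_dvd_prod dvd_power) (auto simp: prime_factors_multiplicity)
    also have "\<dots> = n" using prime_factorization_nat[OF assms(1)] by simp
    finally show ?thesis .
  qed
  then have "real (\<Prod>?S) \<le> real n" using assms by (intro of_nat_mono dvd_imp_le)
  finally have "ln (y ^ card ?S) \<le> ln (real n)"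
    using assms by (subst ln_le_cancel_iff) auto
  then show ?thesis using assms by (simp add: ln_realpow)
qed

text \<open>The cut at \<open>y = ln n\<close> balances two effects: at most \<open>y / ln y\<close>
  prime factors lie above \<open>y\<close>, and each contributes at most
  \<open>exp (e * ln y / y)\<close>, so together they cost only \<open>exp e\<close>.\<close>

lemma multiplicative_arith_le_prime_product:
  fixes f :: "nat \<Rightarrow> real" and h :: "nat \<Rightarrow> real"
  assumes mult: "multiplicative_arith f"
    and nonneg: "\<And>n. n > 0 \<Longrightarrow> f n \<ge> 0"
    and bdd: "\<And>p. prime p \<Longrightarrow> bdd_above (range (\<lambda>\<nu>. f (p ^ \<nu>)))"
    and h: "h \<in> o(\<lambda>p. ln (real p) / real p)"
    and le_h: "\<forall>\<^sub>F p in at_top. prime p \<longrightarrow> prime_power_sup f p \<le> 1 + h p"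
    and "e > 0"
  shows "\<forall>\<^sub>F n in sequentially. 
    f n \<le> (\<Prod>p | prime p \<and> p \<le> nat \<lfloor>ln (real n)\<rfloor>. prime_power_sup f p) * exp e"
proof -
  let ?r = "prime_power_sup f"
  have le_r: "f (p ^ k) \<le> ?r p" if "prime p" for p k
    unfolding prime_power_sup_def using bdd[OF that] by (auto intro: cSUP_upper)
  have r1: "1 \<le> ?r p" if "prime p" for p
    using le_r[OF that, of 0] mult by (simp add: multiplicative_arith_def)
  have "\<forall>\<^sub>F p in at_top. prime p \<longrightarrow> ?r p \<le> 1 + e * (ln (real p) / real p)"
    using landau_o.smallD[OF h \<open>e > 0\<close>] le_h eventually_gt_at_top[of 0]
  proof eventually_elim
    case (elim p)
    then have "h p \<le> e * (ln (real p) / real p)" by (simp add: abs_le_iff)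
    with elim show ?case by linarith
  qed
  then obtain P where P: "\<And>p. p \<ge> P \<Longrightarrow> prime p \<Longrightarrow> ?r p \<le> 1 + e * (ln (real p) / real p)"
    by (auto simp: eventually_at_top_linorder)
  have "filterlim (\<lambda>n. ln (real n)) at_top sequentially"
    by (rule filterlim_compose[OF ln_at_top filterlim_real_sequentially])
  \<comment> \<open>The bound \<open>exp 1\<close> is needed because \<open>ln x / x\<close>
    decreases only from there on; the bound \<open>P\<close> puts all prime factors above
    \<open>ln n\<close> into the range of the estimate on \<open>?r\<close>.\<close>
  then have "\<forall>\<^sub>F n in sequentially. max (exp 1) (real P) \<le> ln (real n)"
    unfolding filterlim_at_top by blast
  then show ?thesis using eventually_gt_at_top[of 0]
  proof eventually_elim
    case (elim n)
    define y where "y = ln (real n)"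
    have y: "exp 1 \<le> y" "real P \<le> y" using elim by (simp_all add: y_def)
    moreover have "exp 1 > (1::real)" by simp
    ultimately have "y > 1" by linarith
    let ?S = "{p. prime p \<and> p \<le> nat \<lfloor>y\<rfloor>}" and ?L = "{p \<in> prime_factors n. y < real p}"
      and ?T = "{p \<in> prime_factors n. real p \<le> y}"
    have "f n = (\<Prod>p\<in>prime_factors n. f (p ^ multiplicity p n))"
      using mult elim by (intro multiplicative_arith_prime_factors) simp_all
    also have "\<dots> \<le> (\<Prod>p\<in>prime_factors n. ?r p)"
      using nonneg le_r by (intro prod_mono) (auto simp: in_prime_factors_iff prime_gt_0_nat)
    also have "prime_factors n = ?T \<union> ?L" by auto
    also have "(\<Prod>p\<in>?T \<union> ?L. ?r p) = (\<Prod>p\<in>?T. ?r p) * (\<Prod>p\<in>?L. ?r p)"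
      by (intro prod.union_disjoint) auto
    also have "\<dots> \<le> (\<Prod>p\<in>?S. ?r p) * exp e"
    proof (intro mult_mono)
      \<comment> \<open>Since every \<open>?r p\<close> is at least 1, including the primes up to
        \<open>y\<close> that do not divide \<open>n\<close> can only enlarge the product.\<close>
      show "(\<Prod>p\<in>?T. ?r p) \<le> (\<Prod>p\<in>?S. ?r p)"
        using r1 \<open>y > 1\<close> by (intro prod_mono2) (auto simp: in_prime_factors_iff le_nat_floor intro: order_trans[OF zero_le_one])
      have "(\<Prod>p\<in>?L. ?r p) \<le> (\<Prod>p\<in>?L. exp (e * (ln y / y)))"
      proof (rule prod_mono, safe)
        fix p assume p: "p \<in> prime_factors n" "y < real p"
        then have "1 \<le> ?r p" using r1[of p] by (simp add: in_prime_factors_iff)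
        then show "0 \<le> ?r p" by simp
        have "P \<le> p" using p y by linarith
        then have "?r p \<le> 1 + e * (ln (real p) / real p)" using P p by auto
        also have "ln (real p) / real p \<le> ln y / y"
          using y p by (intro ln_x_over_x_mono) auto
        then have "1 + e * (ln (real p) / real p) \<le> 1 + e * (ln y / y)"
          using \<open>e > 0\<close> by (intro add_left_mono mult_left_mono) auto
        also have "\<dots> \<le> exp (e * (ln y / y))" by (rule exp_ge_add_one_self)
        finally show "?r p \<le> exp (e * (ln y / y))" .
      qed
      also have "\<dots> = exp (real (card ?L) * (e * (ln y / y)))"
        by (simp flip: exp_of_nat_mult)
      also have "real (card ?L) * (e * (ln y / y)) = e * (real (card ?L) * ln y / y)" by simp
      also have "real (card ?L) * ln y / y \<le> 1"
        using card_large_prime_factors[of n y] elim \<open>y > 1\<close>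
        by (simp add: divide_le_eq_1_pos flip: y_def)
      then have "e * (real (card ?L) * ln y / y) \<le> e"
        by (rule mult_left_le) (use \<open>e > 0\<close> in simp)
      then have "exp (e * (real (card ?L) * ln y / y)) \<le> exp e"
        by (rule exp_le_cancel_iff[THEN iffD2])
      finally show "(\<Prod>p\<in>?L. ?r p) \<le> exp e" .
      show "0 \<le> (\<Prod>p\<in>?S. ?r p)" "0 \<le> (\<Prod>p\<in>?L. ?r p)"
        using r1 by (auto intro!: prod_nonneg intro: order_trans[OF zero_le_one])
    qed
    finally show ?case by (simp add: y_def)
  qed
qed

section \<open>Combination with the Mertens estimate\<close>

lemma prod_eq_prime_weight:
  fixes a :: "nat \<Rightarrow> real"
  shows "(\<Prod>p | prime p \<and> p \<le> x. a p) =
    (\<Prod>p | prime p \<and> p \<le> x. (1 - 1 / real p) * a p) * exp (\<Sum>p | prime p \<and> p \<le> x. prime_weight p)"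
proof -
  \<comment> \<open>The exponential of the weight is the Euler factor
    \<open>1 / (1 - 1 / p)\<close>.\<close>
  have "a p = (1 - 1 / real p) * a p * exp (prime_weight p)" if "prime p" for p
    using prime_gt_1_nat[OF that] that by (simp add: prime_weight_def exp_minus)
  then have "(\<Prod>p | prime p \<and> p \<le> x. a p) =
      (\<Prod>p | prime p \<and> p \<le> x. (1 - 1 / real p) * a p * exp (prime_weight p))"
    by (intro prod.cong) auto
  moreover have "finite {p. prime p \<and> p \<le> x}" by simp
  ultimately show ?thesis by (simp only: exp_sum prod.distrib)
qed

theorem theorem2:
  fixes f :: "nat \<Rightarrow> real" and h :: "nat \<Rightarrow> real" and R :: ereal
  assumes "multiplicative_arith f"
    and "\<And>n. n > 0 \<Longrightarrow> f n \<ge> 0"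
    and "\<And>p. prime p \<Longrightarrow> bdd_above (range (\<lambda>\<nu>. f (p ^ \<nu>)))"
    and "has_prime_product (\<lambda>p. (1 - 1 / real p) * prime_power_sup f p) R"
    and "h \<in> o(\<lambda>p. ln (real p) / real p)"
    and "\<forall>\<^sub>F p in at_top. prime p \<longrightarrow> prime_power_sup f p \<le> 1 + h p"
  shows "limsup (\<lambda>n. ereal (f n / ln (ln (real n)))) \<le> ereal (exp euler_mascheroni) * R"
proof -
  let ?r = "prime_power_sup f" and ?\<gamma> = "euler_mascheroni :: real"
  define A where "A x = (\<Prod>p | prime p \<and> p \<le> x. (1 - 1 / real p) * ?r p)" for x :: nat
  have lim: "(\<lambda>x. ereal (A x)) \<longlonglongrightarrow> R"
    using assms(4) by (simp add: has_prime_product_def A_def)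
  have "1 \<le> ?r p" if "prime p" for p
  proof -
    have "f (p ^ 0) \<le> ?r p"
      unfolding prime_power_sup_def using assms(3)[OF that] by (intro cSUP_upper) auto
    then show ?thesis using assms(1) by (simp add: multiplicative_arith_def)
  qed
  then have "0 \<le> (1 - 1 / real p) * ?r p" if "prime p" for p
    using prime_gt_0_nat[OF that] that by (intro mult_nonneg_nonneg) (auto intro: order_trans[OF zero_le_one])
  then have A_nonneg: "0 \<le> A x" for x
    unfolding A_def by (intro prod_nonneg) auto
  then have "0 \<le> R" by (intro LIMSEQ_le_const[OF lim]) auto
  show ?thesis
  \<comment> \<open>For infinite \<open>R\<close> the right-hand side is infinite as well, since
    \<open>exp \<gamma>\<close> is positive. The improper value 0 falls under the finite
    case.\<close>
  proof (cases R)
    case PInf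
    then show ?thesis by simp
  next
    case MInf
    with \<open>0 \<le> R\<close> show ?thesis by simp
  next
    case (real r)
    with lim have lim_A: "A \<longlonglongrightarrow> r" by simp
    have ln_lim: "filterlim (\<lambda>n. ln (real n)) at_top sequentially"
      by (rule filterlim_compose[OF ln_at_top filterlim_real_sequentially])
    then have lnln_lim: "filterlim (\<lambda>n. ln (ln (real n))) at_top sequentially"
      by (rule filterlim_compose[OF ln_at_top])
    have floor_lim: "filterlim (\<lambda>n. nat \<lfloor>ln (real n)\<rfloor>) at_top sequentially"
      by (rule filterlim_compose[OF filterlim_nat_sequentially filterlim_compose[OF filterlim_floor_sequentially ln_lim]])
    \<comment> \<open>The Mertens estimate is available at integers only. Rounding
      \<open>ln (ln n)\<close> up keeps all primes up to \<open>ln n\<close> inside the sum and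
      costs a factor tending to 1.\<close>
    have N_lim: "filterlim (\<lambda>n. Suc (nat \<lfloor>ln (ln (real n))\<rfloor>)) at_top sequentially"
      by (rule filterlim_compose[OF filterlim_Suc filterlim_compose[OF filterlim_nat_sequentially 
        filterlim_compose[OF filterlim_floor_sequentially lnln_lim]]])
    \<comment> \<open>The three \<open>e\<close> come from the prime sum against
      \<open>harm N\<close>, from \<open>harm N - ln N\<close> against \<open>\<gamma>\<close>, and
      from the large prime factors of \<open>n\<close>.\<close>
    have bound: "limsup (\<lambda>n. ereal (f n / ln (ln (real n)))) \<le> ereal (exp (?\<gamma> + 3 * e) * r)" if "e > 0" for e
    proof -
      let ?u = "\<lambda>n. A (nat \<lfloor>ln (real n)\<rfloor>) * ((1 + 1 / ln (ln (real n))) * exp (?\<gamma> + 3 * e))"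
      have "\<forall>\<^sub>F N in sequentially. harm N - ln (real N) < ?\<gamma> + e"
        using order_tendstoD(2)[OF euler_mascheroni_LIMSEQ] that by simp
      then have "\<forall>\<^sub>F N in sequentially. 
        exp (\<Sum>p | prime p \<and> real p \<le> exp (real N). prime_weight p) \<le> real N * exp (?\<gamma> + 2 * e)"
        using sum_prime_weight_le[OF that] eventually_gt_at_top[of 0]
      proof eventually_elim
        case (elim N)
        then have "(\<Sum>p | prime p \<and> real p \<le> exp (real N). prime_weight p) \<le> ln (real N) + (?\<gamma> + 2 * e)"
          by linarith
        then have "exp (\<Sum>p | prime p \<and> real p \<le> exp (real N). prime_weight p) \<le> exp (ln (real N) + (?\<gamma> + 2 * e))"
          by simp
        also have "\<dots> = real N * exp (?\<gamma> + 2 * e)" using elim by (subst exp_add) simp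
        finally show ?case .
      qed
      then have mertens: "\<forall>\<^sub>F n in sequentially.
        exp (\<Sum>p | prime p \<and> real p \<le> exp (real (Suc (nat \<lfloor>ln (ln (real n))\<rfloor>))). prime_weight p)
          \<le> real (Suc (nat \<lfloor>ln (ln (real n))\<rfloor>)) * exp (?\<gamma> + 2 * e)"
        by (rule eventually_compose_filterlim[OF _ N_lim])
      have "\<forall>\<^sub>F n in sequentially.
          f n \<le> (\<Prod>p | prime p \<and> p \<le> nat \<lfloor>ln (real n)\<rfloor>. ?r p) * exp e"
        by (rule multiplicative_arith_le_prime_product[OF assms(1) _ _ assms(5,6) that])
          (use assms(2,3) in auto)
      then have "\<forall>\<^sub>F n in sequentially. ereal (f n / ln (ln (real n))) \<le> ereal (?u n)"
        using mertens
          filterlim_at_top_dense[THEN iffD1, rule_format, OF lnln_lim, of 0]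
          filterlim_at_top_dense[THEN iffD1, rule_format, OF ln_lim, of 0]
      proof eventually_elim
        case (elim n)
        define l where "l = ln (ln (real n))"
        define N where "N = Suc (nat \<lfloor>l\<rfloor>)"
        define x where "x = nat \<lfloor>ln (real n)\<rfloor>"
        have l: "l > 0" "ln (real n) > 0" using elim by (simp_all add: l_def)
        have N: "l \<le> real N" "real N \<le> l + 1"
          using l unfolding N_def by linarith+
        have "ln (real n) = exp l" using l by (simp add: l_def)
        also have "\<dots> \<le> exp (real N)" using N by simp
        finally have "(\<Sum>p | prime p \<and> p \<le> x. prime_weight p) \<le> (\<Sum>p | prime p \<and> real p \<le> exp (real N). prime_weight p)"
        proof (intro sum_mono2)
          show "finite {p. prime p \<and> real p \<le> exp (real N)}"
            by (rule finite_subset[of _ "{..nat \<lfloor>exp (real N)\<rfloor>}"]) (auto simp: le_nat_floor)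
          have "real x \<le> ln (real n)" using l unfolding x_def by linarith
          moreover assume "ln (real n) \<le> exp (real N)"
          ultimately show "{p. prime p \<and> p \<le> x} \<subseteq> {p. prime p \<and> real p \<le> exp (real N)}"
            by auto
        qed (rule prime_weight_nonneg)
        then have "exp (\<Sum>p | prime p \<and> p \<le> x. prime_weight p) \<le> 
            exp (\<Sum>p | prime p \<and> real p \<le> exp (real N). prime_weight p)" by simp
        also have "\<dots> \<le> real N * exp (?\<gamma> + 2 * e)"
          using elim by (simp add: N_def l_def)
        also have "\<dots> \<le> (l + 1) * exp (?\<gamma> + 2 * e)"
          using N by (intro mult_right_mono) auto
        finally have m: "exp (\<Sum>p | prime p \<and> p \<le> x. prime_weight p) \<le> (l + 1) * exp (?\<gamma> + 2 * e)" .
        have "f n \<le> (\<Prod>p | prime p \<and> p \<le> x. ?r p) * exp e"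
          using elim by (simp add: x_def)
        also have "\<dots> = A x * exp (\<Sum>p | prime p \<and> p \<le> x. prime_weight p) * exp e"
          by (subst prod_eq_prime_weight) (simp add: A_def)
        also have "\<dots> \<le> A x * ((l + 1) * exp (?\<gamma> + 2 * e)) * exp e"
          using m A_nonneg by (intro mult_right_mono mult_left_mono) auto
        \<comment> \<open>Factoring \<open>l\<close> out of \<open>l + 1\<close> isolates the
          denominator of the claim and leaves a factor with a limit.\<close>
        also have "\<dots> = A x * ((1 + 1 / l) * exp (?\<gamma> + 3 * e)) * l"
          using l exp_add[of "?\<gamma> + 2 * e" e] by (simp add: field_simps)
        finally have "f n / l \<le> A x * ((1 + 1 / l) * exp (?\<gamma> + 3 * e))"
          using l by (simp add: pos_divide_le_eq)
        then show ?case by (simp add: x_def l_def)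
      qed
      then have "limsup (\<lambda>n. ereal (f n / ln (ln (real n)))) \<le> limsup (\<lambda>n. ereal (?u n))"
        by (rule Limsup_mono)
      also have "?u \<longlonglongrightarrow> r * ((1 + 0) * exp (?\<gamma> + 3 * e))"
        by (intro tendsto_intros filterlim_compose[OF lim_A floor_lim] tendsto_divide_0[OF tendsto_const]
          filterlim_at_top_imp_at_infinity lnln_lim)
      then have "limsup (\<lambda>n. ereal (?u n)) = ereal (r * ((1 + 0) * exp (?\<gamma> + 3 * e)))"
        by (intro lim_imp_Limsup) auto
      finally show ?thesis by (simp add: mult.commute)
    qed
    \<comment> \<open>The limsup does not depend on \<open>e\<close>, so \<open>e\<close> may tend
      to 0 in its upper bound.\<close>
    have "((\<lambda>e. ereal (exp (?\<gamma> + 3 * e) * r)) \<longlongrightarrow> ereal (exp (?\<gamma> + 3 * 0) * r)) (at_right 0)"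
      by (intro tendsto_intros)
    moreover have "\<forall>\<^sub>F e in at_right 0.
      limsup (\<lambda>n. ereal (f n / ln (ln (real n)))) \<le> ereal (exp (?\<gamma> + 3 * e) * r)"
      using eventually_at_right_less by eventually_elim (rule bound)
    ultimately have "limsup (\<lambda>n. ereal (f n / ln (ln (real n)))) \<le> ereal (exp (?\<gamma> + 3 * 0) * r)"
      by (intro tendsto_lowerbound[of _ _ "at_right (0::real)"]) auto
    then show ?thesis using real by simp
  qed
qed

end
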